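(* For every integer $k\ge 0$, let $t_k=3^k\cdot 6^{(4^k-3k-1)/9}$. Then every graph $G$ with tree-width $\mathrm{tw}(G)\le k$ has a $t_k$-track layout.
   Context: All graphs are finite, simple and undirected. A colouring of $G$ is a partition $\{V_i:i\in I\}$ of $V(G)$ such that no edge has both end-vertices in the same class. A track assignment is a colouring together with a total order $<_i$ of each $V_i$ (each $(V_i,<_i)$ is a track). An X-crossing consists of two edges $vw$, $xy$ with $v,x\in V_i$, $w,y\in V_j$ for distinct tracks $i\neq j$, $v<_i x$ and $y<_j w$. A $t$-track layout is a track assignment with $t$ tracks and no X-crossing. *)

theory Defs
  imports "HOL-Library.Disjoint_Sets" "Graph_Theory.Graph_Theory"
begin

text \<open>
  Finite simple undirected graphs are \<^locale>\<open>pair_graph\<close>s: finite loop-free digraphs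
  without parallel arcs whose arc relation is symmetric.  An undirected edge \<open>vw\<close> is present
  as both arcs \<open>(v, w)\<close> and \<open>(w, v)\<close>.
\<close>

section \<open>Tree-width\<close>

text \<open>
  The library's \<^const>\<open>tree\<close> does not describe undirected trees represented as symmetric
  digraphs, since there every edge gives the directed cycle \<open>a, b, a\<close>.  In a \<^locale>\<open>pair_graph\<close>
  the cycles of the undirected graph are the directed cycles of length at least 3.
  \<^const>\<open>connected\<close> includes non-emptiness of the vertex set.
\<close>

definition undirected_tree :: "'n pair_pre_digraph \<Rightarrow> bool" where
  "undirected_tree T \<longleftrightarrow>
     pair_graph T \<and> connected (with_proj T) \<and>
     \<not> (\<exists>p. pre_digraph.cycle (with_proj T) p \<and> 3 \<le> length p)"

text \<open>
  Since \<^const>\<open>connected\<close> requires a non-empty vertex set, the last condition also says that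
  every vertex lies in some bag.
\<close>

definition tree_decomposition ::
    "'a pair_pre_digraph \<Rightarrow> 'n pair_pre_digraph \<Rightarrow> ('n \<Rightarrow> 'a set) \<Rightarrow> bool" where
  "tree_decomposition G T B \<longleftrightarrow>
     undirected_tree T \<and>
     (\<forall>x \<in> pverts T. B x \<subseteq> pverts G) \<and>
     (\<forall>(v, w) \<in> parcs G. \<exists>x \<in> pverts T. v \<in> B x \<and> w \<in> B x) \<and>
     (\<forall>v \<in> pverts G. connected (with_proj T \<restriction> {x \<in> pverts T. v \<in> B x}))"

definition decomposition_width :: "'n pair_pre_digraph \<Rightarrow> ('n \<Rightarrow> 'a set) \<Rightarrow> nat" where
  "decomposition_width T B = Max ((\<lambda>x. card (B x)) ` pverts T) - 1"

text \<open>
  Every finite tree is isomorphic to one whose nodes are natural numbers, so ranging over these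
  is no restriction.  The graph without vertices gets tree-width 0 instead of \<open>-1\<close>, because of
  truncated subtraction.
\<close>

definition treewidth :: "'a pair_pre_digraph \<Rightarrow> nat" where
  "treewidth G = (LEAST w. \<exists>(T :: nat pair_pre_digraph) B.
     tree_decomposition G T B \<and> decomposition_width T B = w)"

text \<open>The minimum in \<^const>\<open>treewidth\<close> ranges over a non-empty set.\<close>

lemma ex_tree_decomposition:
  assumes "pair_graph G"
  shows "\<exists>(T :: nat pair_pre_digraph) B. tree_decomposition G T B"
proof -
  interpret pair_graph G by (fact assms)
  let ?T = "\<lparr>pverts = {0}, parcs = {}\<rparr> :: nat pair_pre_digraph"
  have conn: "connected H" if "verts H = {0}" for H :: "(nat, nat \<times> nat) pre_digraph"
    using that by (auto simp: connected_def strongly_connected_def reachable_def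
        intro: rtrancl_on_refl)
  have g: "pair_graph ?T"
    by unfold_locales (auto simp: symmetric_def sym_def)
  have nocyc: "\<not> pre_digraph.cycle (with_proj ?T) p" for p
    by (auto simp: pre_digraph.cycle_def pre_digraph.awalk_def)
  have "tree_decomposition G ?T (\<lambda>_. pverts G)"
    using g nocyc in_arcsD1 in_arcsD2
    by (auto simp: tree_decomposition_def undirected_tree_def intro!: conn)
  then show ?thesis by blast
qed

section \<open>Track layouts\<close>

text \<open>
  The classes of a colouring form a family indexed by the set \<open>I\<close> of colours; some classes
  may be empty.
\<close>

definition colouring :: "'a pair_pre_digraph \<Rightarrow> 'i set \<Rightarrow> ('i \<Rightarrow> 'a set) \<Rightarrow> bool" where
  "colouring G I V \<longleftrightarrow>
     (\<Union>i\<in>I. V i) = pverts G \<and> disjoint_family_on V I \<and>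
     (\<forall>(v, w) \<in> parcs G. \<forall>i\<in>I. \<not> (v \<in> V i \<and> w \<in> V i))"

text \<open>\<open>(v, x) \<in> R i\<close> stands for \<open>v <\<^sub>i x\<close>.\<close>

definition track_assignment ::
    "'a pair_pre_digraph \<Rightarrow> 'i set \<Rightarrow> ('i \<Rightarrow> 'a set) \<Rightarrow> ('i \<Rightarrow> 'a rel) \<Rightarrow> bool" where
  "track_assignment G I V R \<longleftrightarrow>
     colouring G I V \<and>
     (\<forall>i\<in>I. R i \<subseteq> V i \<times> V i \<and> strict_linear_order_on (V i) (R i))"

definition has_X_crossing ::
    "'a pair_pre_digraph \<Rightarrow> 'i set \<Rightarrow> ('i \<Rightarrow> 'a set) \<Rightarrow> ('i \<Rightarrow> 'a rel) \<Rightarrow> bool" where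
  "has_X_crossing G I V R \<longleftrightarrow>
     (\<exists>i\<in>I. \<exists>j\<in>I. i \<noteq> j \<and>
        (\<exists>v w x y. (v, w) \<in> parcs G \<and> (x, y) \<in> parcs G \<and>
           v \<in> V i \<and> x \<in> V i \<and> w \<in> V j \<and> y \<in> V j \<and>
           (v, x) \<in> R i \<and> (y, w) \<in> R j))"

definition has_track_layout :: "nat \<Rightarrow> 'a pair_pre_digraph \<Rightarrow> bool" where
  "has_track_layout t G \<longleftrightarrow>
     (\<exists>V R. track_assignment G {..<t} V R \<and> \<not> has_X_crossing G {..<t} V R)"

section \<open>The bound\<close>

text \<open>Neither the subtraction nor the division below truncates.\<close>

definition track_bound :: "nat \<Rightarrow> nat" where
  "track_bound k = 3 ^ k * 6 ^ ((4 ^ k - 3 * k - 1) div 9)"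

lemma track_bound_exponent_exact:
  fixes k :: nat
  shows "3 * k + 1 \<le> 4 ^ k" and "9 dvd 4 ^ k - 3 * k - 1"
proof -
  have "\<exists>m. 4 ^ k = 9 * m + 3 * k + (1 :: nat)"
  proof (induction k)
    case 0
    show ?case by simp
  next
    case (Suc k)
    then obtain m where "4 ^ k = 9 * m + 3 * k + (1 :: nat)" by blast
    then have "4 ^ Suc k = 9 * (4 * m + k) + 3 * Suc k + (1 :: nat)" by simp
    then show ?case by blast
  qed
  then show "3 * k + 1 \<le> 4 ^ k" and "9 dvd 4 ^ k - 3 * k - 1" by auto
qed

end

theory Submission
  imports Defs
begin

text \<open>
  A graph of tree-width at most \<open>k\<close> is a spanning subgraph of one built by repeatedly adding a
  vertex adjacent to a clique of at most \<open>k\<close> vertices.  Such a graph has a partition into bags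
  indexed by a rooted tree: edges stay in a bag or join it to its parent, the neighbours of a bag
  in its parent form a clique, and each bag is built in the same way with \<open>k - 1\<close>.  By induction
  every bag has a track layout.  The track of a vertex records the depth modulo 3 of its bag, the
  set of tracks met by the clique above that bag, and its track within the bag; bags are ordered
  by depth, then by their parents, then by the cliques above them.

  Let \<open>t\<^sub>k\<close> be the number of tracks and \<open>c\<^sub>k\<close> the number of sets of tracks that cliques can
  meet.  Then \<open>t\<^sub>k\<^sub>+\<^sub>1 = 3 c\<^sub>k t\<^sub>k\<close>, and since a clique meets one bag or two adjacent ones,
  \<open>c\<^sub>k\<^sub>+\<^sub>1 \<le> 3 c\<^sub>k\<^sup>2 + 3 c\<^sub>k\<^sup>4 \<le> 6 c\<^sub>k\<^sup>4\<close>.  Hence \<open>c\<^sub>k \<le> 6\<close> to the power \<open>(4\<^sup>k - 1) / 3\<close>, which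
  gives the bound.
\<close>

section \<open>Graphs built along cliques\<close>

definition clique_in :: "'a rel \<Rightarrow> 'a set \<Rightarrow> bool" where
  "clique_in E C \<longleftrightarrow> (\<forall>u\<in>C. \<forall>v\<in>C. u \<noteq> v \<longrightarrow> (u, v) \<in> E)"

lemma clique_in_mono: "clique_in E C \<Longrightarrow> E \<subseteq> E' \<Longrightarrow> D \<subseteq> C \<Longrightarrow> clique_in E' D"
  by (auto simp: clique_in_def)

text \<open>These are the chordal graphs with cliques of at most \<open>k + 1\<close> vertices,
  given by a reversed perfect elimination ordering. As \<open>C\<close> may have fewer than
  \<open>k\<close> vertices, they include more than the k-trees.\<close>

inductive clique_built :: "nat \<Rightarrow> 'a set \<Rightarrow> 'a rel \<Rightarrow> bool" for k where
  empty: "clique_built k {} {}"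
| insert: "clique_built k V E \<Longrightarrow> v \<notin> V \<Longrightarrow> C \<subseteq> V \<Longrightarrow> clique_in E C \<Longrightarrow> card C \<le> k \<Longrightarrow>
    clique_built k (insert v V) (E \<union> {v} \<times> C \<union> C \<times> {v})"

lemma
  assumes "clique_built k V E"
  shows clique_built_finite: "finite V" and clique_built_subset: "E \<subseteq> V \<times> V"
  using assms by induction auto

lemma clique_built_0_no_edges: "clique_built 0 V E \<Longrightarrow> E = {}"
proof (induction rule: clique_built.induct)
  case (insert V E v C)
  then have "finite C"
    by (meson clique_built_finite finite_subset)
  then show ?case
    using insert by auto
qed simp

text \<open>Attaches a whole bag at once. The vertices of \<open>D\<close> enter one by one, each
  joined to \<open>K\<close> and to those of \<open>D\<close> already present, which are at most
  \<open>k\<close> since one place of \<open>K \<union> D\<close> is its own.\<close>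

lemma clique_built_add_clique:
  assumes "clique_built k W E" "finite D" "D \<inter> W = {}" "K \<subseteq> W" "clique_in E K"
    "card (K \<union> D) \<le> Suc k"
  shows "clique_built k (W \<union> D) (E \<union> {(a, b) \<in> (K \<union> D) \<times> (K \<union> D). a \<noteq> b})"
  using assms(2,3,6)
proof (induction D)
  case empty
  have "E \<union> {(a, b) \<in> (K \<union> {}) \<times> (K \<union> {}). a \<noteq> b} = E"
    using assms(5) by (auto simp: clique_in_def)
  then show ?case using assms(1) by simp
next
  case (insert v D)
  let ?E = "E \<union> {(a, b) \<in> (K \<union> D) \<times> (K \<union> D). a \<noteq> b}"
  have fin: "finite (K \<union> D)"
    using insert(1) assms(4) clique_built_finite[OF assms(1)] finite_subset by blast
  have v: "v \<notin> W \<union> D" "v \<notin> K \<union> D"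
    using insert assms(4) by auto
  have card: "card (K \<union> D) \<le> k"
    using insert.prems(2) fin v(2) by simp
  have IH: "clique_built k (W \<union> D) ?E"
    using insert card by auto
  have "clique_built k (insert v (W \<union> D)) (?E \<union> {v} \<times> (K \<union> D) \<union> (K \<union> D) \<times> {v})"
    by (rule clique_built.insert[OF IH v(1)]) (use assms(4) card in \<open>auto simp: clique_in_def\<close>)
  also have "?E \<union> {v} \<times> (K \<union> D) \<union> (K \<union> D) \<times> {v} =
      E \<union> {(a, b) \<in> (K \<union> insert v D) \<times> (K \<union> insert v D). a \<noteq> b}"
    using v by auto
  finally show ?case by simp
qed

section \<open>Trees and tree decompositions\<close>

text \<open>Cut the path after its last visit to \<open>w\<close>: in the induction, a step out of
  \<open>w\<close> restarts the remaining path.\<close>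

lemma rtrancl_on_first_step:
  assumes "(w, x) \<in> rtrancl_on X A" "w \<noteq> x"
  shows "\<exists>q\<in>X. (w, q) \<in> A \<and> (q, x) \<in> rtrancl_on (X - {w}) A"
  using assms
proof (induction rule: rtrancl_on_induct)
  case (step y z)
  show ?case
  proof (cases "y = w")
    case True
    then show ?thesis using step by auto
  next
    case False
    then show ?thesis using step by (blast intro: rtrancl_on_into_rtrancl_on)
  qed
qed simp

lemma pawalk_verts_snoc:
  "pcas p es q \<Longrightarrow> pawalk_verts p (es @ [(q, w)]) = pawalk_verts p es @ [w]"
  by (induction es arbitrary: p) auto

lemma pcas_snoc: "pcas p es q \<Longrightarrow> pcas p (es @ [(q, w)]) w"
  by (induction es arbitrary: p) auto

text \<open>Otherwise a path from \<open>p\<close> to \<open>q\<close> avoiding \<open>w\<close>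
  would close up through \<open>w\<close> to a cycle; it has length at least 3 because the path has
  an arc.\<close>

lemma undirected_tree_neighbour_unique:
  assumes T: "undirected_tree T" and w: "(w, p) \<in> parcs T" "(w, q) \<in> parcs T" "w \<notin> X"
    and pq: "(p, q) \<in> rtrancl_on X (parcs T)"
  shows "p = q"
proof (rule ccontr)
  assume ne: "p \<noteq> q"
  interpret T: pair_graph T using T by (simp add: undirected_tree_def)
  \<comment> \<open>Paths in this subgraph stay inside \<open>X\<close>, hence avoid
    \<open>w\<close>, and can be shortened to have distinct vertices.\<close>
  let ?H = "\<lparr>pverts = X, parcs = parcs T \<inter> X \<times> X\<rparr>"
  interpret H: pair_wf_digraph ?H by unfold_locales auto
  have "(p, q) \<in> rtrancl_on X (parcs T \<inter> X \<times> X)"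
    using pq by (induction rule: rtrancl_on_induct) (auto intro: rtrancl_on_into_rtrancl_on)
  then have "p \<rightarrow>\<^sup>*\<^bsub>?H\<^esub> q"
    by (simp add: reachable_def)
  then obtain es where path: "H.awalk p es q" "distinct (pawalk_verts p es)"
    using H.reachable_apath unfolding H.apath_def by blast
  then have es: "set es \<subseteq> parcs T" "set (pawalk_verts p es) \<subseteq> X" "pcas p es q"
    by (fastforce elim: H.awalkE)+
  have "es \<noteq> []" using es(3) ne by auto
  let ?c = "(w, p) # es @ [(q, w)]"
  have "T.cycle ?c"
    unfolding T.cycle_def
  proof (intro exI[of _ w] conjI)
    have "(q, w) \<in> parcs T"
      using w(2) T.arcs_symmetric by blast
    then show "T.awalk w ?c w"
      using es w by (auto simp: T.awalk_def pcas_snoc simp del: T.cas_append_iff dest: T.in_arcsD1)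
    show "distinct (tl (pawalk_verts w ?c))"
      using es path(2) w by (auto simp: pawalk_verts_snoc)
  qed simp
  moreover have "3 \<le> length ?c" using \<open>es \<noteq> []\<close> by (cases es) auto
  ultimately show False using T unfolding undirected_tree_def by blast
qed

text \<open>Connectedness is about the symmetrised digraph, but the arcs of \<open>T\<close> are
  symmetric already, so undirected paths are directed ones.\<close>

lemma connected_induced_rtrancl_on:
  assumes "pair_graph T" "connected (with_proj T \<restriction> X)"
  shows "X \<noteq> {}" "u \<in> X \<Longrightarrow> v \<in> X \<Longrightarrow> (u, v) \<in> rtrancl_on X (parcs T)"
proof -
  interpret pair_graph T by fact
  show "X \<noteq> {}"
    using assms(2) by (auto simp: connected_def strongly_connected_def)
  assume uv: "u \<in> X" "v \<in> X"
  have "(\<Union>e\<in>{e \<in> parcs T. fst e \<in> X \<and> snd e \<in> X}. {(fst e, snd e), (snd e, fst e)}) \<subseteq> parcs T"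
    using arcs_symmetric by auto
  moreover have "(u, v) \<in> rtrancl_on X
      (\<Union>e\<in>{e \<in> parcs T. fst e \<in> X \<and> snd e \<in> X}. {(fst e, snd e), (snd e, fst e)})"
    using assms(2) uv
    by (simp add: connected_def strongly_connected_def reachable_def mk_symmetric_def)
  ultimately show "(u, v) \<in> rtrancl_on X (parcs T)"
    by (meson order_refl rtrancl_on_mono)
qed

lemma undirected_tree_rtrancl_on:
  assumes "undirected_tree T"
  shows "pverts T \<noteq> {}" "u \<in> pverts T \<Longrightarrow> v \<in> pverts T \<Longrightarrow> (u, v) \<in> rtrancl_on (pverts T) (parcs T)"
proof -
  interpret pair_graph T using assms by (simp add: undirected_tree_def)
  have "mk_symmetric (with_proj T \<restriction> pverts T) = mk_symmetric (with_proj T)"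
    using in_arcsD1 in_arcsD2 by (auto simp: mk_symmetric_def)
  then have *: "connected (with_proj T \<restriction> pverts T)"
    using assms by (simp add: connected_def undirected_tree_def)
  show "pverts T \<noteq> {}" "u \<in> pverts T \<Longrightarrow> v \<in> pverts T \<Longrightarrow> (u, v) \<in> rtrancl_on (pverts T) (parcs T)"
    using connected_induced_rtrancl_on[OF pair_graph *] by auto
qed

lemma rtrancl_on_leaves_set:
  assumes "(s, x) \<in> rtrancl_on X A" "s \<in> S" "x \<notin> S"
  shows "\<exists>p\<in>S. \<exists>w\<in>X - S. (p, w) \<in> A"
  using assms by (induction rule: rtrancl_on_induct) auto

text \<open>Turn every bag into a clique and collect the tree nodes one by one, keeping the
  collected set \<open>S\<close> connected; each new bag then attaches along a clique.\<close>

lemma tree_decomposition_clique_built: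
  assumes td: "tree_decomposition G T B" and G: "pair_graph G"
    and card: "\<And>x. x \<in> pverts T \<Longrightarrow> card (B x) \<le> Suc k"
  shows "\<exists>E. clique_built k (pverts G) E \<and> parcs G \<subseteq> E"
proof -
  interpret G: pair_graph G by fact
  have tree: "undirected_tree T" using td by (simp add: tree_decomposition_def)
  interpret T: pair_graph T using tree by (simp add: undirected_tree_def)
  have Bsub: "B x \<subseteq> pverts G" if "x \<in> pverts T" for x
    using td that by (auto simp: tree_decomposition_def)
  have conn: "connected (with_proj T \<restriction> {x \<in> pverts T. v \<in> B x})" if "v \<in> pverts G" for v
    using td that by (auto simp: tree_decomposition_def)
  have fin: "finite (B x)" if "x \<in> pverts T" for x
    using Bsub[OF that] G.pair_finite_verts finite_subset by blast
  let ?E = "\<lambda>S. {(a, b). a \<noteq> b \<and> (\<exists>x\<in>S. a \<in> B x \<and> b \<in> B x)}"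
  let ?conn = "\<lambda>S. \<forall>u\<in>S. \<forall>v\<in>S. (u, v) \<in> rtrancl_on S (parcs T)"
  have grow: "\<exists>S \<subseteq> pverts T. card S = Suc n \<and> ?conn S \<and> clique_built k (\<Union>(B ` S)) (?E S)"
    if "n < card (pverts T)" for n
    using that
  proof (induction n)
    case 0
    obtain x where x: "x \<in> pverts T"
      using undirected_tree_rtrancl_on(1)[OF tree] by blast
    have "clique_built k (B x) (?E {x})"
      using clique_built_add_clique[OF clique_built.empty fin[OF x], where K = "{}" and k = k] card[OF x]
      by (simp add: clique_in_def case_prod_beta' conj_ac)
    then show ?case
      using x by (intro exI[of _ "{x}"]) simp
  next
    case (Suc n)
    then obtain S where S: "S \<subseteq> pverts T" "card S = Suc n" "?conn S"
        "clique_built k (\<Union>(B ` S)) (?E S)"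
      by auto
    have finS: "finite S" using S(2) card.infinite by fastforce
    obtain s where s: "s \<in> S" using S(2) by fastforce
    obtain z where z: "z \<in> pverts T" "z \<notin> S"
      using Suc.prems S(1,2) by (metis less_irrefl subset_antisym subsetI)
    obtain p w where w: "p \<in> S" "w \<in> pverts T - S" "(p, w) \<in> parcs T"
      using rtrancl_on_leaves_set[of s z "pverts T" "parcs T" S] s z S(1)
        undirected_tree_rtrancl_on(2)[OF tree, of s z] by blast
    have wp: "(w, p) \<in> parcs T" using w T.arcs_symmetric by blast
    \<comment> \<open>The nodes whose bags contain \<open>v\<close> connect \<open>w\<close> to
      \<open>x\<close>. The neighbour \<open>q\<close> of \<open>w\<close> where such a path leaves
      \<open>w\<close> for good is also joined to \<open>p\<close> outside \<open>w\<close>, through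
      \<open>S\<close>, so \<open>q = p\<close>. Thus the old vertices of \<open>B w\<close> all lie
      in the single clique \<open>B p\<close>.\<close>
    have inter: "v \<in> B p" if v: "v \<in> B w" "v \<in> B x" "x \<in> S" for v x
    proof -
      let ?X = "{x \<in> pverts T. v \<in> B x}"
      have "v \<in> pverts G" using Bsub v w by auto
      then have "(w, x) \<in> rtrancl_on ?X (parcs T)"
        using connected_induced_rtrancl_on(2)[OF T.pair_graph conn] v w S(1) by auto
      then obtain q where q: "q \<in> ?X" "(w, q) \<in> parcs T" "(q, x) \<in> rtrancl_on (?X - {w}) (parcs T)"
        using rtrancl_on_first_step[of w x ?X "parcs T"] w v by blast
      have "(q, x) \<in> rtrancl_on (pverts T - {w}) (parcs T)"
        by (rule rtrancl_on_mono[OF _ _ q(3)]) auto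
      moreover have "(x, p) \<in> rtrancl_on (pverts T - {w}) (parcs T)"
        by (rule rtrancl_on_mono[of "parcs T" _ S]) (use S v w in auto)
      ultimately have "(q, p) \<in> rtrancl_on (pverts T - {w}) (parcs T)"
        by (rule rtrancl_on_trans)
      then have "q = p"
        by (rule undirected_tree_neighbour_unique[OF tree q(2) wp, rotated]) simp
      then show ?thesis using q(1) by simp
    qed
    let ?W = "\<Union>(B ` S)" and ?D = "B w - \<Union>(B ` S)" and ?K = "B w \<inter> \<Union>(B ` S)"
    have KD: "?K \<union> ?D = B w" by auto
    have "clique_in (?E S) ?K"
      unfolding clique_in_def using inter w(1) by blast
    then have "clique_built k (?W \<union> ?D) (?E S \<union> {(a, b) \<in> (?K \<union> ?D) \<times> (?K \<union> ?D). a \<noteq> b})"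
      using fin[of w] card[of w] w(2) KD by (intro clique_built_add_clique S) auto
    moreover have "?W \<union> ?D = \<Union>(B ` insert w S)" by auto
    moreover have "?E S \<union> {(a, b) \<in> (?K \<union> ?D) \<times> (?K \<union> ?D). a \<noteq> b} = ?E (insert w S)"
      unfolding KD by auto
    ultimately have "clique_built k (\<Union>(B ` insert w S)) (?E (insert w S))"
      by simp
    moreover have "?conn (insert w S)"
    proof -
      let ?R = "rtrancl_on (insert w S) (parcs T)"
      have SS: "(u, v) \<in> ?R" if "u \<in> S" "v \<in> S" for u v
        by (rule rtrancl_on_mono[of "parcs T" _ S]) (use S that in auto)
      have "(u, w) \<in> ?R" if "u \<in> S" for u
        using SS[OF that w(1)] w(3) by (auto intro: rtrancl_on_into_rtrancl_on)
      moreover have "(w, u) \<in> ?R" if "u \<in> S" for u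
        using SS[OF w(1) that] wp by (auto intro: converse_rtrancl_on_into_rtrancl_on)
      ultimately show ?thesis using SS by auto
    qed
    moreover have "card (insert w S) = Suc (Suc n)" "insert w S \<subseteq> pverts T"
      using S w finS by auto
    ultimately show ?case by blast
  qed
  have "0 < card (pverts T)"
    using undirected_tree_rtrancl_on(1)[OF tree] T.pair_finite_verts by (simp add: card_gt_0_iff)
  then obtain S where S: "S \<subseteq> pverts T" "card S = card (pverts T)"
      "clique_built k (\<Union>(B ` S)) (?E S)"
    using grow[of "card (pverts T) - 1"] by auto
  have "S = pverts T"
    using S T.pair_finite_verts by (simp add: card_subset_eq)
  moreover have "\<Union>(B ` pverts T) = pverts G"
    using Bsub connected_induced_rtrancl_on(1)[OF T.pair_graph conn] by blast
  moreover have "parcs G \<subseteq> ?E (pverts T)"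
    using td G.no_loops' by (fastforce simp: tree_decomposition_def)
  ultimately show ?thesis using S(3) by auto
qed

lemma treewidth_clique_built:
  assumes "pair_graph G" "treewidth G \<le> k"
  shows "\<exists>E. clique_built k (pverts G) E \<and> parcs G \<subseteq> E"
proof -
  have "\<exists>w (T :: nat pair_pre_digraph) B. tree_decomposition G T B \<and> decomposition_width T B = w"
    using ex_tree_decomposition[OF assms(1)] by blast
  then have "\<exists>(T :: nat pair_pre_digraph) B.
      tree_decomposition G T B \<and> decomposition_width T B = treewidth G"
    unfolding treewidth_def by (rule LeastI_ex)
  then obtain T :: "nat pair_pre_digraph" and B where
    TB: "tree_decomposition G T B" "decomposition_width T B \<le> k"
    using assms(2) by metis
  interpret T: pair_graph T
    using TB(1) by (simp add: tree_decomposition_def undirected_tree_def)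
  have "card (B x) \<le> Suc k" if "x \<in> pverts T" for x
  proof -
    have "card (B x) \<le> Max ((\<lambda>x. card (B x)) ` pverts T)"
      using that T.pair_finite_verts by (intro Max_ge) auto
    \<comment> \<open>The truncated subtraction in the width is harmless: the bound
      \<open>Suc k\<close> holds also if all bags are empty.\<close>
    then show ?thesis using TB(2) unfolding decomposition_width_def by linarith
  qed
  then show ?thesis
    using tree_decomposition_clique_built[OF TB(1) assms(1)] by blast
qed

section \<open>Tree partitions\<close>

definition bag :: "'a set \<Rightarrow> ('a \<Rightarrow> 'n) \<Rightarrow> 'n \<Rightarrow> 'a set" where
  "bag V node x = {v \<in> V. node v = x}"

text \<open>
  Nodes of the rooted tree are addressed by lists: \<open>m # x\<close> is a child of \<open>x\<close>, and the root
  is the empty list.  \<open>top x\<close> is the clique in the bag of the parent of \<open>x\<close> that contains all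
  neighbours of the bag of \<open>x\<close> there.
\<close>

locale tree_partition =
  fixes V :: "'a set" and E :: "'a rel"
    and node :: "'a \<Rightarrow> nat list" and top :: "nat list \<Rightarrow> 'a set"
  assumes finite_V: "finite V" and E_subset: "E \<subseteq> V \<times> V" and sym_E: "sym E"
    and edge: "(u, v) \<in> E \<Longrightarrow> node u = node v
        \<or> (\<exists>m. node v = m # node u) \<and> u \<in> top (node v)
        \<or> (\<exists>m. node u = m # node v) \<and> v \<in> top (node u)"
    and top: "v \<in> V \<Longrightarrow> node v = m # x \<Longrightarrow>
        top (m # x) \<noteq> {} \<and> clique_in E (top (m # x)) \<and> top (m # x) \<subseteq> bag V node x"
begin

text \<open>Nodes of adjacent vertices are equal or parent and child, and a tree has no
  triangle.\<close>

lemma clique_nodes: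
  assumes "clique_in E C" "C \<noteq> {}"
  shows "(\<exists>x. node ` C = {x}) \<or> (\<exists>m x. node ` C = {x, m # x})"
proof (cases "\<exists>a\<in>C. \<exists>b\<in>C. node a \<noteq> node b")
  case False
  then obtain x where "\<forall>b\<in>C. node b = x"
    by blast
  then have "node ` C = {x}"
    using assms(2) by auto
  then show ?thesis by (intro disjI1 exI)
next
  case True
  have adj: "node a = node b \<or> (\<exists>m. node b = m # node a) \<or> (\<exists>m. node a = m # node b)"
    if "a \<in> C" "b \<in> C" for a b
  proof (cases "a = b")
    case False
    then have "(a, b) \<in> E" using assms(1) that by (simp add: clique_in_def)
    then show ?thesis using edge[of a b] by auto
  qed simp
  obtain a b where ab: "a \<in> C" "b \<in> C" "node a \<noteq> node b" using True by blast
  then obtain a b m where ab: "a \<in> C" "b \<in> C" "node b = m # node a"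
    using adj[OF ab(1,2)] by blast
  \<comment> \<open>By list lengths, a node that is equal or adjacent to \<open>x\<close> and also
    to \<open>m # x\<close> must be one of these two.\<close>
  have list: "z = x \<or> z = m # x" if "x = z \<or> (\<exists>m. z = m # x) \<or> (\<exists>m. x = m # z)"
    "m # x = z \<or> (\<exists>n. z = n # m # x) \<or> (\<exists>n. m # x = n # z)" for x z :: "nat list"
    using that by auto
  have "node c \<in> {node a, m # node a}" if "c \<in> C" for c
    using list[OF adj[OF ab(1) that]] adj[OF ab(2) that] unfolding ab(3) by blast
  then have "node ` C \<subseteq> {node a, m # node a}" by blast
  moreover have "{node a, m # node a} \<subseteq> node ` C"
    using ab by (metis bot.extremum image_eqI insert_subset)
  ultimately have "node ` C = {node a, m # node a}" by (rule subset_antisym)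
  then show ?thesis by (intro disjI2 exI)
qed

end

text \<open>Induction along the construction. A new vertex \<open>v\<close> with neighbours
  \<open>C\<close> joins the lower bag if \<open>C\<close> meets two bags, the root bag if
  \<open>C\<close> is empty, and otherwise starts a new child, with \<open>C\<close> as its top
  clique, of the bag containing \<open>C\<close>. In each case at most \<open>k\<close> neighbours
  share the bag of \<open>v\<close>.\<close>

lemma clique_built_tree_partition:
  assumes "clique_built (Suc k) V E"
  shows "\<exists>node top. tree_partition V E node top \<and>
    (\<forall>x. clique_built k (bag V node x) (E \<inter> bag V node x \<times> bag V node x))"
  using assms
proof (induction)
  case empty
  have "tree_partition {} {} (\<lambda>_. []) (\<lambda>_. {})"
    by unfold_locales (auto simp: sym_def)
  moreover have "clique_built k (bag {} node x) ({} \<inter> bag {} node x \<times> bag {} node x)"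
    for node :: "'a \<Rightarrow> nat list" and x
    by (simp add: bag_def clique_built.empty)
  ultimately show ?case by blast
next
  case (insert V E v C)
  then obtain node top where tp: "tree_partition V E node top" and
    bags: "\<And>x. clique_built k (bag V node x) (E \<inter> bag V node x \<times> bag V node x)"
    by blast
  interpret tree_partition V E node top by fact
  let ?V = "insert v V" and ?E = "E \<union> {v} \<times> C \<union> C \<times> {v}"
  note v = \<open>v \<notin> V\<close> and C = \<open>C \<subseteq> V\<close> \<open>clique_in E C\<close> \<open>card C \<le> Suc k\<close>
  have finC: "finite C" using C(1) finite_V finite_subset by blast
  have vC: "v \<notin> C" and vE: "(v, u) \<notin> E" "(u, v) \<notin> E" for u
    using v C(1) E_subset by auto
  have bag_other: "bag ?V (node(v := y)) x = bag V node x" if "x \<noteq> y" for x y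
    using that v by (auto simp: bag_def)
  have E_other: "?E \<inter> bag V node x \<times> bag V node x = E \<inter> bag V node x \<times> bag V node x" for x
    using v by (auto simp: bag_def)
  have bag_same: "bag ?V (node(v := y)) y = insert v (bag V node y)" for y
    using v by (auto simp: bag_def)
  have E_same: "?E \<inter> insert v (bag V node y) \<times> insert v (bag V node y) =
      (E \<inter> bag V node y \<times> bag V node y) \<union> {v} \<times> (C \<inter> bag V node y) \<union> (C \<inter> bag V node y) \<times> {v}" for y
    using vE vC by auto
  \<comment> \<open>Any bag holding at most \<open>k\<close> neighbours of \<open>v\<close> can
    receive \<open>v\<close>: these neighbours form a clique there, and the other bags do not
    change.\<close>
  have bags': "clique_built k (bag ?V (node(v := y)) x)
      (?E \<inter> bag ?V (node(v := y)) x \<times> bag ?V (node(v := y)) x)"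
    if "card (C \<inter> bag V node y) \<le> k" for x y
  proof (cases "x = y")
    case True
    have "clique_in (E \<inter> bag V node y \<times> bag V node y) (C \<inter> bag V node y)"
      using C(2) by (auto simp: clique_in_def)
    then show ?thesis
      unfolding True bag_same E_same
      using v that by (intro clique_built.insert[OF bags]) (auto simp: bag_def)
  next
    case False
    then show ?thesis by (simp only: bag_other E_other bags not_False_eq_True)
  qed
  have top_mono: "top (m # x) \<noteq> {} \<and> clique_in ?E (top (m # x)) \<and> top (m # x) \<subseteq> bag ?V (node(v := y)) x"
    if "u \<in> V" "node u = m # x" for u m x y
    using top[OF that] v clique_in_mono[of E "top (m # x)" ?E] by (auto simp: bag_def)
  have E_sub': "?E \<subseteq> ?V \<times> ?V" and sym': "sym ?E"
    using C(1) E_subset sym_E by (auto simp: sym_def)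
  show ?case
  proof (cases "\<exists>x. node ` C \<subseteq> {x}")
    case False
    then have "C \<noteq> {}" by auto
    then obtain m x where nodes: "node ` C = {x, m # x}"
      using clique_nodes[OF C(2)] False by auto
    then obtain a b where ab: "a \<in> C" "node a = x" "b \<in> C" "node b = m # x"
      by (metis imageE insertI1 insertI2 singletonI)
    \<comment> \<open>Every vertex of \<open>C\<close> in the upper bag is adjacent to
      \<open>b\<close> in the lower one, so the existing top clique already contains it.\<close>
    have in_top: "c \<in> top (m # x)" if "c \<in> C" "node c = x" for c
    proof -
      have "c \<noteq> b" using ab that by auto
      then have "(c, b) \<in> E" using C(2) ab that by (auto simp: clique_in_def)
      then show ?thesis using edge[of c b] ab that by auto
    qed
    have "a \<notin> bag V node (m # x)"
      using ab by (auto simp: bag_def)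
    then have "C \<inter> bag V node (m # x) \<subset> C"
      using ab(1) by blast
    then have "card (C \<inter> bag V node (m # x)) \<le> k"
      using psubset_card_mono[OF finC] C(3) by (meson leD leI less_Suc_eq_le order_less_le_trans)
    note bags'[OF this]
    moreover have "tree_partition ?V ?E (node(v := m # x)) top"
    proof (unfold_locales; (fact E_sub' sym')?)
      show "finite ?V" using finite_V by simp
      fix u w assume uw: "(u, w) \<in> ?E"
      have "node c = x \<and> c \<in> top (m # x) \<or> node c = m # x" if "c \<in> C" for c
        using that nodes in_top by blast
      note C_node = this
      show "(node(v := m # x)) u = (node(v := m # x)) w
          \<or> (\<exists>n. (node(v := m # x)) w = n # (node(v := m # x)) u) \<and> u \<in> top ((node(v := m # x)) w)
          \<or> (\<exists>n. (node(v := m # x)) u = n # (node(v := m # x)) w) \<and> w \<in> top ((node(v := m # x)) u)"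
      proof (cases "(u, w) \<in> E")
        case True
        then show ?thesis using edge[OF True] vE by auto
      next
        case False
        then have "u = v \<and> w \<in> C \<or> w = v \<and> u \<in> C" using uw by auto
        then show ?thesis using C_node[of w] C_node[of u] vC by auto
      qed
    next
      fix u n y assume "u \<in> ?V" "(node(v := m # x)) u = n # y"
      \<comment> \<open>If \<open>u\<close> is the new vertex, then \<open>b\<close> is an old
        vertex at the same node.\<close>
      then have "\<exists>u'\<in>V. node u' = n # y"
        using ab C(1) by (auto split: if_splits)
      then show "top (n # y) \<noteq> {} \<and> clique_in ?E (top (n # y)) \<and>
          top (n # y) \<subseteq> bag ?V (node(v := m # x)) y"
        using top_mono by blast
    qed
    ultimately show ?thesis by blast
  next
    case True
    show ?thesis
    proof (cases "C = {}")
      case True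
      have "tree_partition ?V ?E (node(v := [])) top"
      proof (unfold_locales; (fact E_sub' sym')?)
        show "finite ?V" using finite_V by simp
        fix u w assume uw: "(u, w) \<in> ?E"
        then show "(node(v := [])) u = (node(v := [])) w
            \<or> (\<exists>n. (node(v := [])) w = n # (node(v := [])) u) \<and> u \<in> top ((node(v := [])) w)
            \<or> (\<exists>n. (node(v := [])) u = n # (node(v := [])) w) \<and> w \<in> top ((node(v := [])) u)"
          using edge[of u w] vE True by auto
      next
        fix u n y assume "u \<in> ?V" "(node(v := [])) u = n # y"
        then show "top (n # y) \<noteq> {} \<and> clique_in ?E (top (n # y)) \<and>
            top (n # y) \<subseteq> bag ?V (node(v := [])) y"
          by (intro top_mono[of u]) (auto split: if_splits)
      qed
      then show ?thesis using bags'[of "[]"] True by auto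
    next
      case False
      then obtain x where x: "\<forall>c\<in>C. node c = x" using True by auto
      \<comment> \<open>A number \<open>m\<close> that begins no address in use makes
        \<open>m # x\<close> a new node below any \<open>x\<close>. The unspecified head of the root
        address merely excludes one more value.\<close>
      have "finite ((\<lambda>u. hd (node u)) ` V)" using finite_V by simp
      then obtain m where "m \<notin> (\<lambda>u. hd (node u)) ` V"
        using ex_new_if_finite infinite_UNIV_nat by blast
      then have m: "node u \<noteq> m # x" if "u \<in> V" for u x
        using that by (metis image_eqI list.sel(1))
      let ?node = "node(v := m # x)" and ?top = "top(m # x := C)"
      have "tree_partition ?V ?E ?node ?top"
      proof (unfold_locales; (fact E_sub' sym')?)
        show "finite ?V" using finite_V by simp
        fix u w assume uw: "(u, w) \<in> ?E"
        show "?node u = ?node w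
            \<or> (\<exists>n. ?node w = n # ?node u) \<and> u \<in> ?top (?node w)
            \<or> (\<exists>n. ?node u = n # ?node w) \<and> w \<in> ?top (?node u)"
        proof (cases "(u, w) \<in> E")
          case True
          then have "u \<in> V" "w \<in> V" using E_subset by auto
          then show ?thesis using edge[OF True] m v by auto
        next
          case False
          then show ?thesis using uw x vC by auto
        qed
      next
        fix u n y assume u: "u \<in> ?V" "?node u = n # y"
        show "?top (n # y) \<noteq> {} \<and> clique_in ?E (?top (n # y)) \<and> ?top (n # y) \<subseteq> bag ?V ?node y"
        proof (cases "u = v")
          case True
          then have "n = m" "y = x" using u by auto
          then show ?thesis
            using False C x vC clique_in_mono[of E C ?E C] by (auto simp: bag_def)
        next
          case False
          then have "u \<in> V" "node u = n # y" using u by auto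
          moreover have "n # y \<noteq> m # x" using m calculation by metis
          ultimately show ?thesis using top_mono[of u n y] by auto
        qed
      qed
      moreover have "C \<inter> bag V node (m # x) = {}" using m by (auto simp: bag_def)
      then have "card (C \<inter> bag V node (m # x)) \<le> k" by simp
      note bags'[OF this]
      ultimately show ?thesis by blast
    qed
  qed
qed

section \<open>Layouts\<close>

text \<open>The orders of all tracks come from one injective position function.\<close>

definition layout ::
    "'a set \<Rightarrow> 'a rel \<Rightarrow> 'c set \<Rightarrow> 'c set set \<Rightarrow> ('a \<Rightarrow> 'c) \<Rightarrow> ('a \<Rightarrow> nat) \<Rightarrow> bool" where
  "layout V E S F col pos \<longleftrightarrow>
     col ` V \<subseteq> S \<and> inj_on pos V \<and> (\<forall>(u, v)\<in>E. col u \<noteq> col v) \<and>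
     (\<forall>(v, w)\<in>E. \<forall>(x, y)\<in>E. col v = col x \<longrightarrow> col w = col y \<longrightarrow> pos v < pos x \<longrightarrow> \<not> pos y < pos w) \<and>
     (\<forall>C\<subseteq>V. C \<noteq> {} \<longrightarrow> clique_in E C \<longrightarrow> col ` C \<in> F)"

lemma layoutD:
  assumes "layout V E S F col pos"
  shows "v \<in> V \<Longrightarrow> col v \<in> S" and "inj_on pos V" and "(v, w) \<in> E \<Longrightarrow> col v \<noteq> col w"
    and "(v, w) \<in> E \<Longrightarrow> (x, y) \<in> E \<Longrightarrow> col v = col x \<Longrightarrow> col w = col y \<Longrightarrow> pos v < pos x \<Longrightarrow> \<not> pos y < pos w"
    and "C \<subseteq> V \<Longrightarrow> C \<noteq> {} \<Longrightarrow> clique_in E C \<Longrightarrow> col ` C \<in> F"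
  using assms unfolding layout_def by blast+

text \<open>All conditions on colours depend only on which colours are equal, or on images of
  cliques.\<close>

lemma layout_rename:
  assumes L: "layout V E S F col pos" and h: "inj_on h S" and E: "E \<subseteq> V \<times> V"
  shows "layout V E (h ` S) ((`) h ` F) (h \<circ> col) pos"
proof -
  have eq: "(h \<circ> col) u = (h \<circ> col) v \<longleftrightarrow> col u = col v" if "u \<in> V" "v \<in> V" for u v
    using layoutD(1)[OF L] h that by (simp add: inj_on_eq_iff)
  have E': "u \<in> V" "v \<in> V" if "(u, v) \<in> E" for u v
    using E that by auto
  show ?thesis
    unfolding layout_def
  proof (intro conjI ballI allI impI; (clarify?))
    show "(h \<circ> col) v \<in> h ` S" if "v \<in> V" for v
      using layoutD(1)[OF L that] by simp
    show "inj_on pos V" by (rule layoutD(2)[OF L])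
    show False if "(u, v) \<in> E" "(h \<circ> col) u = (h \<circ> col) v" for u v
      using that eq E' layoutD(3)[OF L] by metis
    show False if "(v, w) \<in> E" "(x, y) \<in> E" "(h \<circ> col) v = (h \<circ> col) x" "(h \<circ> col) w = (h \<circ> col) y"
      "pos v < pos x" "pos y < pos w" for v w x y
      using that eq E' layoutD(4)[OF L] by metis
    show "(h \<circ> col) ` C \<in> (`) h ` F" if "C \<subseteq> V" "C \<noteq> {}" "clique_in E C" for C
      using layoutD(5)[OF L that] by (metis image_comp image_eqI)
  qed
qed

text \<open>The position of an element is the number of its predecessors.\<close>

lemma ex_positions:
  assumes "finite V" "inj_on f V" "trans r" "irrefl r" "total r"
  shows "\<exists>pos :: 'a \<Rightarrow> nat. inj_on pos V \<and> (\<forall>u\<in>V. \<forall>v\<in>V. pos u < pos v \<longrightarrow> (f u, f v) \<in> r)"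
proof -
  define pos where "pos v = card {u \<in> V. (f u, f v) \<in> r}" for v
  have less: "pos u < pos v" if "u \<in> V" "v \<in> V" "(f u, f v) \<in> r" for u v
    unfolding pos_def
  proof (rule psubset_card_mono)
    show "{w \<in> V. (f w, f u) \<in> r} \<subset> {w \<in> V. (f w, f v) \<in> r}"
      using that assms(3,4) unfolding irrefl_def by (blast dest: transD)
  qed (use assms(1) in simp)
  have total: "(f u, f v) \<in> r \<or> (f v, f u) \<in> r" if "u \<in> V" "v \<in> V" "u \<noteq> v" for u v
    using that assms(2,5) by (simp add: total_on_def inj_on_eq_iff)
  have "inj_on pos V"
    by (rule inj_onI) (metis less total less_irrefl)
  moreover have "(f u, f v) \<in> r" if "u \<in> V" "v \<in> V" "pos u < pos v" for u v
    using that less[of v u] total[of u v] by fastforce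
  ultimately show ?thesis by blast
qed

section \<open>Lexicographic orders on lists of numbers\<close>

lemma lex_append_cases:
  "length xs = length ys \<Longrightarrow> (xs @ zs, ys @ ws) \<in> lex r \<Longrightarrow>
    (xs, ys) \<in> lex r \<or> xs = ys \<and> (zs, ws) \<in> lex r"
  by (induction xs ys rule: list_induct2) auto

lemma total_lenlex_less_than: "total (lenlex (less_than :: nat rel))"
  by (intro total_lenlex) (auto simp: total_on_def)

lemma trans_lenlex_less_than: "trans (lenlex (less_than :: nat rel))"
  by (intro lenlex_transI) simp

lemma irrefl_lenlex_less_than: "irrefl (lenlex (less_than :: nat rel))"
  using wf_irrefl[OF wf_lenlex[OF wf_less_than]] by (auto simp: irrefl_def)

section \<open>Combining the layouts of the bags along the tree\<close>

locale layered_layout = tree_partition V E node top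
  for V :: "'a set" and E and node :: "'a \<Rightarrow> nat list" and top +
  fixes col :: "nat list \<Rightarrow> 'a \<Rightarrow> 'c" and pos :: "nat list \<Rightarrow> 'a \<Rightarrow> nat"
    and S :: "'c set" and F :: "'c set set" and f0 :: "'c set"
  assumes bag_layout: "layout (bag V node x) (E \<inter> bag V node x \<times> bag V node x) S F (col x) (pos x)"
    and f0: "f0 \<in> F"
begin

text \<open>No clique lies above the root; the default \<open>f0\<close> keeps its value inside
  \<open>F\<close>.\<close>

primrec cover :: "nat list \<Rightarrow> 'c set" where
  "cover [] = f0"
| "cover (m # x) = col x ` top (m # x)"

definition rank :: "nat list \<Rightarrow> nat" where
  "rank y = sum (pos (tl y)) (top y)"

text \<open>
  Siblings are compared by the sum of the positions of their top cliques.  If two of these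
  cliques meet the same tracks, one lies before the other on every track, and the sum detects which.
\<close>

primrec key :: "nat list \<Rightarrow> nat list" where
  "key [] = []"
| "key (m # x) = key x @ [rank (m # x), m]"

text \<open>A breadth-first order: keys start with the key of the parent, so at equal depth the
  parents are compared first and then the ranks.\<close>

definition node_less :: "nat list \<Rightarrow> nat list \<Rightarrow> bool" where
  "node_less x y \<longleftrightarrow> length x < length y \<or> length x = length y \<and> (key x, key y) \<in> lex less_than"

text \<open>Its length is twice the depth plus one, so \<open>lenlex\<close> compares depths first,
  then nodes, and only inside a bag the positions.\<close>

definition vertex_key :: "'a \<Rightarrow> nat list" where
  "vertex_key v = key (node v) @ [pos (node v) v]"

definition track :: "'a \<Rightarrow> nat \<times> 'c set \<times> 'c" where
  "track v = (length (node v) mod 3, cover (node v), col (node v) v)"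

lemma length_key [simp]: "length (key x) = 2 * length x"
  by (induction x) auto

text \<open>The entry \<open>m\<close> after each rank separates siblings of equal rank.\<close>

lemma key_inject: "key x = key y \<Longrightarrow> x = y"
proof (induction x arbitrary: y)
  case Nil
  then have "length (key y) = 0" by (metis key.simps(1) list.size(3))
  then show ?case by simp
next
  case (Cons m x)
  then have "length (key (m # x)) = length (key y)" by metis
  then obtain n z where "y = n # z" by (cases y) auto
  then show ?case using Cons by auto
qed

lemma inj_on_vertex_key: "inj_on vertex_key V"
proof (rule inj_onI)
  fix u v assume uv: "u \<in> V" "v \<in> V" "vertex_key u = vertex_key v"
  then have "node u = node v" "pos (node u) u = pos (node v) v"
    using key_inject by (auto simp: vertex_key_def)
  then show "u = v"
    using layoutD(2)[OF bag_layout, of "node v"] uv by (auto simp: bag_def inj_on_def)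
qed

lemma vertex_key_less:
  assumes "(vertex_key u, vertex_key v) \<in> lenlex less_than"
  shows "node_less (node u) (node v) \<or> node u = node v \<and> pos (node v) u < pos (node v) v"
proof -
  consider "length (node u) < length (node v)" |
    "length (node u) = length (node v)" "(vertex_key u, vertex_key v) \<in> lex less_than"
    using assms by (auto simp: lenlex_conv vertex_key_def)
  then show ?thesis
  proof cases
    case 2
    then have "(key (node u), key (node v)) \<in> lex less_than \<or>
        key (node u) = key (node v) \<and> ([pos (node u) u], [pos (node v) v]) \<in> lex less_than"
      unfolding vertex_key_def by (intro lex_append_cases) simp_all
    then show ?thesis
      using 2(1) key_inject[of "node u" "node v"] by (auto simp: node_less_def)
  qed (simp add: node_less_def)
qed

lemma node_less_asym: "node_less x y \<Longrightarrow> \<not> node_less y x"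
  using wf_not_sym[OF wf_lex[OF wf_less_than]] by (auto simp: node_less_def)

lemma node_less_irrefl: "\<not> node_less x x"
  using node_less_asym by blast

lemma node_less_length: "node_less x y \<Longrightarrow> length x \<le> length y"
  by (auto simp: node_less_def)

lemma node_less_child: "node_less x y \<Longrightarrow> length x = length y \<Longrightarrow> node_less (m # x) (n # y)"
  by (auto simp: node_less_def intro: lex_append_rightI)

lemma node_less_sibling: "rank (m # x) < rank (n # x) \<Longrightarrow> node_less (m # x) (n # x)"
  by (auto simp: node_less_def intro: lex_append_leftI)

lemma in_bag: "v \<in> V \<Longrightarrow> v \<in> bag V node (node v)"
  by (simp add: bag_def)

lemma cover_in_F:
  assumes "v \<in> V" shows "cover (node v) \<in> F"
proof (cases "node v")
  case Nil
  then show ?thesis using f0 by simp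
next
  case (Cons m x)
  have "clique_in (E \<inter> bag V node x \<times> bag V node x) (top (m # x))"
    using top[OF assms Cons] by (auto simp: clique_in_def)
  then show ?thesis
    using layoutD(5)[OF bag_layout] top[OF assms Cons] Cons by simp
qed

text \<open>Each clique uses a colour at most once, so equal covers give a colour-preserving
  bijection \<open>f\<close> between the top cliques, with \<open>f a = b\<close>. Since
  \<open>a\<close> precedes \<open>b\<close>, the absence of X-crossings in the parent bag forbids
  \<open>f\<close> to move any vertex backwards.\<close>

lemma rank_less:
  assumes w: "w \<in> V" "node w = m # x" and y: "y \<in> V" "node y = n # x"
    and cover: "cover (m # x) = cover (n # x)"
    and a: "a \<in> top (m # x)" "b \<in> top (n # x)" "col x a = col x b" "pos x a < pos x b"
  shows "rank (m # x) < rank (n # x)"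
proof -
  let ?C = "top (m # x)" and ?D = "top (n # x)"
  let ?E = "E \<inter> bag V node x \<times> bag V node x"
  note L = bag_layout[of x]
  have C: "clique_in ?E ?C" "?C \<subseteq> bag V node x" and D: "clique_in ?E ?D" "?D \<subseteq> bag V node x"
    using top[OF w] top[OF y] by (auto simp: clique_in_def)
  have fin: "finite ?C" "finite ?D"
    using C(2) D(2) finite_V by (auto simp: bag_def intro: finite_subset)
  have inj: "u = u'" if "u \<in> ?D" "u' \<in> ?D" "col x u = col x u'" for u u'
    using that D(1) layoutD(3)[OF L, of u u'] by (auto simp: clique_in_def)
  have injC: "u = u'" if "u \<in> ?C" "u' \<in> ?C" "col x u = col x u'" for u u'
    using that C(1) layoutD(3)[OF L, of u u'] by (auto simp: clique_in_def)
  have "\<exists>u'\<in>?D. col x u' = col x u" if "u \<in> ?C" for u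
    using cover that by (metis (mono_tags, lifting) imageE imageI cover.simps(2))
  then obtain f where f: "\<And>u. u \<in> ?C \<Longrightarrow> f u \<in> ?D \<and> col x (f u) = col x u"
    by metis
  have f_inj: "inj_on f ?C"
    using f injC by (metis inj_onI)
  have "f ` ?C = ?D"
  proof (intro equalityI subsetI)
    fix d assume d: "d \<in> ?D"
    then obtain u where "u \<in> ?C" "col x u = col x d"
      using cover by (metis (mono_tags, lifting) imageE imageI cover.simps(2))
    then have "f u = d" using f inj d by metis
    then show "d \<in> f ` ?C" using \<open>u \<in> ?C\<close> by blast
  qed (use f in blast)
  have fa: "f a = b" using f[OF a(1)] inj a by metis
  have le: "pos x u \<le> pos x (f u)" if u: "u \<in> ?C" for u
  proof (cases "u = a")
    case False
    \<comment> \<open>The edges from \<open>a\<close> to \<open>u\<close> and from \<open>b\<close>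
      to \<open>f u\<close> run between the same two tracks and must not cross.\<close>
    then have "(a, u) \<in> ?E" using C(1)[unfolded clique_in_def, rule_format, OF a(1) u] by simp
    moreover have "f u \<noteq> b" using False f_inj fa a(1) u by (metis inj_on_eq_iff)
    then have "(b, f u) \<in> ?E"
      using D(1)[unfolded clique_in_def, rule_format, OF a(2), of "f u"] f[OF u] by simp
    ultimately show ?thesis
      using layoutD(4)[OF L, of a u b "f u"] a f[OF u] by auto
  qed (use a fa in simp)
  have "sum (pos x) ?C < sum (\<lambda>u. pos x (f u)) ?C"
    using le a fa by (intro sum_strict_mono_ex1 fin) auto
  also have "\<dots> = sum (pos x) ?D"
    using sum.reindex[OF f_inj, of "pos x"] \<open>f ` ?C = ?D\<close> by (simp add: comp_def)
  finally show ?thesis by (simp add: rank_def)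
qed

section \<open>Absence of X-crossings\<close>

lemma edge_cases:
  assumes "(v, w) \<in> E"
  obtains "node v = node w" | m where "node w = m # node v" "v \<in> top (node w)"
    | m where "node v = m # node w" "w \<in> top (node v)"
  using edge[OF assms] by blast

text \<open>Along an edge the depth changes by 0, 1 or -1, which are distinct modulo 3; hence edges
  between the same tracks are of the same kind.\<close>

lemma edge_length_mod:
  assumes "(v, w) \<in> E" "(x, y) \<in> E"
    and "length (node v) mod 3 = length (node x) mod 3" "length (node w) mod 3 = length (node y) mod 3"
  shows "node v = node w \<Longrightarrow> node x = node y"
    and "node w = m # node v \<Longrightarrow> \<exists>n. node y = n # node x \<and> x \<in> top (node y)"
proof -
  show "node x = node y" if "node v = node w"
    using assms(2) by (rule edge_cases) (use assms(3,4) that in \<open>auto simp: mod_Suc split: if_splits\<close>)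
  show "\<exists>n. node y = n # node x \<and> x \<in> top (node y)" if "node w = m # node v"
    using assms(2) by (rule edge_cases) (use assms(3,4) that in \<open>auto simp: mod_Suc split: if_splits\<close>)
qed

lemma no_crossing_same_bag:
  assumes E: "(v, w) \<in> E" "(x, y) \<in> E" and track: "track v = track x" "track w = track y"
    and vx: "(vertex_key v, vertex_key x) \<in> lenlex less_than"
    and yw: "(vertex_key y, vertex_key w) \<in> lenlex less_than"
    and vw: "node v = node w"
  shows False
proof -
  have xy: "node x = node y"
    using edge_length_mod(1)[OF E] track vw by (simp add: track_def)
  \<comment> \<open>Different bags would have to precede each other in both directions.\<close>
  have nodes: "node v = node x"
    using vertex_key_less[OF vx] vertex_key_less[OF yw] vw xy node_less_asym by metis
  have V: "v \<in> V" "w \<in> V" "x \<in> V" "y \<in> V" using E E_subset by auto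
  let ?b = "bag V node (node x)"
  have "(v, w) \<in> E \<inter> ?b \<times> ?b" "(x, y) \<in> E \<inter> ?b \<times> ?b"
    using E V nodes vw xy by (auto simp: bag_def)
  moreover have "pos (node x) v < pos (node x) x" "pos (node x) y < pos (node x) w"
    using vertex_key_less[OF vx] vertex_key_less[OF yw] nodes vw xy node_less_irrefl by auto
  moreover have "col (node x) v = col (node x) x" "col (node x) w = col (node x) y"
    using track nodes vw xy by (auto simp: track_def)
  ultimately show False
    using layoutD(4)[OF bag_layout] by blast
qed

text \<open>If the upper bags differ, their order passes to the children; if they agree,
  \<open>rank_less\<close> orders the children. Either way the bag of \<open>w\<close> strictly
  precedes that of \<open>y\<close>, against the crossing.\<close>

lemma no_crossing_child:
  assumes E: "(v, w) \<in> E" "(x, y) \<in> E" and track: "track v = track x" "track w = track y"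
    and vx: "(vertex_key v, vertex_key x) \<in> lenlex less_than"
    and yw: "(vertex_key y, vertex_key w) \<in> lenlex less_than"
    and vw: "node w = m # node v" "v \<in> top (node w)"
  shows False
proof -
  obtain n where xy: "node y = n # node x" "x \<in> top (node y)"
    using edge_length_mod(2)[OF E _ _ vw(1)] track by (auto simp: track_def)
  have V: "w \<in> V" "y \<in> V" using E E_subset by auto
  have "length (node y) \<le> length (node w)"
    using vertex_key_less[OF yw] node_less_length by auto
  moreover have "length (node v) \<le> length (node x)"
    using vertex_key_less[OF vx] node_less_length by auto
  \<comment> \<open>Both pairs differ in depth by exactly one, so the two inequalities, on opposite
    ends of the edges, force equality.\<close>
  ultimately have len: "length (node v) = length (node x)"
    using vw xy by simp
  have "\<not> node_less (node w) (node y)"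
    using vertex_key_less[OF yw] node_less_asym node_less_irrefl by metis
  then have "\<not> node_less (node v) (node x)"
    using node_less_child[OF _ len] vw xy by auto
  then have nodes: "node v = node x" and pos: "pos (node x) v < pos (node x) x"
    using vertex_key_less[OF vx] by auto
  have "rank (m # node x) < rank (n # node x)"
  proof (rule rank_less[OF V(1) _ V(2) xy(1)])
    show "node w = m # node x" using vw nodes by simp
    show "cover (m # node x) = cover (n # node x)"
      using track(2) vw(1) xy(1) nodes unfolding track_def by (metis prod.inject)
    show "v \<in> top (m # node x)" "x \<in> top (n # node x)" using vw xy nodes by auto
    show "col (node x) v = col (node x) x" using track nodes by (simp add: track_def)
  qed (fact pos)
  then have "node_less (node w) (node y)"
    using node_less_sibling vw xy nodes by simp
  then show False using \<open>\<not> node_less (node w) (node y)\<close> by simp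
qed

lemma no_crossing:
  assumes E: "(v, w) \<in> E" "(x, y) \<in> E" and track: "track v = track x" "track w = track y"
    and vx: "(vertex_key v, vertex_key x) \<in> lenlex less_than"
    and yw: "(vertex_key y, vertex_key w) \<in> lenlex less_than"
  shows False
  using E(1)
proof (rule edge_cases)
  assume "node v = node w"
  then show False using no_crossing_same_bag[OF assms] by simp
next
  fix m assume "node w = m # node v" "v \<in> top (node w)"
  then show False using no_crossing_child[OF assms] by simp
next
  fix m assume "node v = m # node w"
  \<comment> \<open>Reversing both edges and exchanging them turns this into the previous
    case.\<close>
  have E': "(w, v) \<in> E" "(y, x) \<in> E" using E sym_E by (auto dest: symD)
  have "\<exists>n. node x = n # node y \<and> y \<in> top (node x)"
    using edge_length_mod(2)[OF E' _ _ \<open>node v = m # node w\<close>] track by (simp add: track_def)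
  then show False
    using no_crossing_child[OF E'(2,1) track(2)[symmetric] track(1)[symmetric] yw vx] by blast
qed

section \<open>The sets of tracks met by cliques\<close>

definition tracks :: "(nat \<times> 'c set \<times> 'c) set" where
  "tracks = {..<3} \<times> F \<times> S"

text \<open>The first family serves cliques inside one bag, the second those meeting a bag and a
  child of it. It may contain sets met by no clique; it only has to be small.\<close>

definition covers :: "(nat \<times> 'c set \<times> 'c) set set" where
  "covers = (\<lambda>(d, f, g). {d} \<times> {f} \<times> g) ` ({..<3} \<times> F \<times> F) \<union>
    (\<lambda>(d, f, g, f', g'). {d} \<times> {f} \<times> g \<union> {Suc d mod 3} \<times> {f'} \<times> g') ` ({..<3} \<times> F \<times> F \<times> F \<times> F)"

lemma track_bag_clique:
  assumes "C \<subseteq> bag V node x" "C \<noteq> {}" "clique_in E C"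
  shows "track ` C = {length x mod 3} \<times> {cover x} \<times> col x ` C" "col x ` C \<in> F" "cover x \<in> F"
proof -
  have node: "node c = x" if "c \<in> C" for c using assms(1) that by (auto simp: bag_def)
  show "track ` C = {length x mod 3} \<times> {cover x} \<times> col x ` C"
    using node assms(2) by (auto simp: track_def image_iff)
  have "clique_in (E \<inter> bag V node x \<times> bag V node x) C"
    using assms by (auto simp: clique_in_def)
  then show "col x ` C \<in> F"
    using layoutD(5)[OF bag_layout] assms by blast
  show "cover x \<in> F"
    using assms cover_in_F by (auto simp: bag_def)
qed

lemma track_clique:
  assumes C: "C \<subseteq> V" "C \<noteq> {}" "clique_in E C"
  shows "track ` C \<in> covers"
proof -
  consider x where "node ` C = {x}" | m x where "node ` C = {x, m # x}"
    using clique_nodes[OF C(3,2)] by blast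
  then show ?thesis
  proof cases
    case 1
    then have "C \<subseteq> bag V node x" using C(1) by (auto simp: bag_def)
    note * = track_bag_clique[OF this C(2,3)]
    have "(\<lambda>(d, f, g). {d} \<times> {f} \<times> g) (length x mod 3, cover x, col x ` C) \<in> covers"
      unfolding covers_def by (intro UnI1 imageI) (use * in simp)
    then show ?thesis using * by simp
  next
    case 2
    let ?D = "C \<inter> bag V node x" and ?D' = "C \<inter> bag V node (m # x)"
    have "x \<in> node ` C" "m # x \<in> node ` C" using 2 by auto
    then have ne: "?D \<noteq> {}" "?D' \<noteq> {}" using C(1) by (auto simp: bag_def)
    have cl: "clique_in E ?D" "clique_in E ?D'" using C(3) by (auto simp: clique_in_def)
    have "node c = x \<or> node c = m # x" if "c \<in> C" for c using 2 that by blast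
    then have "C = ?D \<union> ?D'" using C(1) by (auto simp: bag_def)
    then have img: "track ` C = track ` ?D \<union> track ` ?D'" by (metis image_Un)
    note * = track_bag_clique[OF Int_lower2 ne(1) cl(1)] track_bag_clique[OF Int_lower2 ne(2) cl(2)]
    have "(\<lambda>(d, f, g, f', g'). {d} \<times> {f} \<times> g \<union> {Suc d mod 3} \<times> {f'} \<times> g')
        (length x mod 3, cover x, col x ` ?D, cover (m # x), col (m # x) ` ?D') \<in> covers"
      unfolding covers_def by (intro UnI2 imageI) (use * in simp)
    moreover have "Suc (length x mod 3) mod 3 = length (m # x) mod 3" by (simp add: mod_Suc_eq)
    ultimately show ?thesis unfolding img *(1,4) by simp
  qed
qed

lemma layered_layout: "\<exists>p. layout V E tracks covers track p"
proof -
  obtain p :: "'a \<Rightarrow> nat" where p: "inj_on p V"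
      "\<And>u v. u \<in> V \<Longrightarrow> v \<in> V \<Longrightarrow> p u < p v \<Longrightarrow> (vertex_key u, vertex_key v) \<in> lenlex less_than"
    using ex_positions[OF finite_V inj_on_vertex_key trans_lenlex_less_than irrefl_lenlex_less_than
        total_lenlex_less_than] by blast
  have tracks: "track v \<in> tracks" if "v \<in> V" for v
    using cover_in_F[OF that] layoutD(1)[OF bag_layout in_bag[OF that]]
    by (simp add: track_def tracks_def)
  have proper: "track u \<noteq> track v" if uv: "(u, v) \<in> E" for u v
  proof
    assume eq: "track u = track v"
    have V: "u \<in> V" "v \<in> V" using uv E_subset by auto
    \<comment> \<open>Parent and child differ in depth modulo 3, so only edges inside a bag
      remain.\<close>
    have "node u = node v"
      using uv by (rule edge_cases) (use eq in \<open>auto simp: track_def mod_Suc split: if_splits\<close>)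
    then show False
      using layoutD(3)[OF bag_layout, of u v "node u"] uv eq V by (auto simp: bag_def track_def)
  qed
  have crossing: "\<not> p y < p w" if *: "(v, w) \<in> E" "(x, y) \<in> E" "track v = track x" "track w = track y"
    "p v < p x" for v w x y
  proof
    assume yw: "p y < p w"
    have V: "v \<in> V" "w \<in> V" "x \<in> V" "y \<in> V" using *(1,2) E_subset by auto
    show False by (rule no_crossing[OF *(1-4) p(2)[OF V(1,3) *(5)] p(2)[OF V(4,2) yw]])
  qed
  have "layout V E tracks covers track p"
    unfolding layout_def using tracks p(1) proper crossing track_clique by blast
  then show ?thesis by blast
qed

end

section \<open>Recursion for the number of tracks\<close>

text \<open>The tracks and covers are chosen before the graph: all bags must share the same
  \<open>S\<close> and \<open>F\<close> for the combined layout to be countable.\<close>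

lemma clique_built_Suc_layout:
  fixes S :: "'c set"
  assumes IH: "\<forall>(V :: 'a set) E. clique_built k V E \<longrightarrow> (\<exists>col pos. layout V E S F col pos)"
    and F: "finite S" "finite F" "F \<noteq> {}"
  shows "\<exists>(S' :: (nat \<times> 'c set \<times> 'c) set) F'. finite S' \<and> finite F' \<and> F' \<noteq> {} \<and>
    card S' = 3 * card F * card S \<and> card F' \<le> 6 * card F ^ 4 \<and>
    (\<forall>(V :: 'a set) E. clique_built (Suc k) V E \<longrightarrow> (\<exists>col pos. layout V E S' F' col pos))"
proof -
  define S' :: "(nat \<times> 'c set \<times> 'c) set" where "S' = {..<3} \<times> F \<times> S"
  define A where "A = (\<lambda>(d, f, g). {d} \<times> {f} \<times> g) ` ({..<3 :: nat} \<times> F \<times> F)"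
  define A' where "A' = (\<lambda>(d, f, g, f', g'). {d} \<times> {f} \<times> g \<union> {Suc d mod 3} \<times> {f'} \<times> g') `
    ({..<3} \<times> F \<times> F \<times> F \<times> F)"
  let ?c = "card F"
  have fin: "finite S'" "finite (A \<union> A')" using F by (simp_all add: S'_def A_def A'_def)
  have ne: "A \<union> A' \<noteq> {}" using F(3) by (auto simp: A_def lessThan_empty_iff bot_nat_def)
  have "card A \<le> 3 * (?c * ?c)"
    unfolding A_def by (rule order_trans[OF card_image_le]) (use F in \<open>simp_all add: card_cartesian_product\<close>)
  moreover have "card A' \<le> 3 * (?c * (?c * (?c * ?c)))"
    unfolding A'_def by (rule order_trans[OF card_image_le]) (use F in \<open>simp_all add: card_cartesian_product\<close>)
  \<comment> \<open>As \<open>F\<close> is nonempty, the one-bag term is absorbed by the fourth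
    power, which gives the factor 3 + 3 = 6.\<close>
  moreover have "?c * ?c \<le> ?c * (?c * (?c * ?c))"
    using F by (simp add: card_gt_0_iff Suc_le_eq)
  moreover have "card (A \<union> A') \<le> card A + card A'" by (rule card_Un_le)
  moreover have "?c ^ 4 = ?c * (?c * (?c * ?c))" by (simp add: eval_nat_numeral)
  ultimately have card: "card (A \<union> A') \<le> 6 * ?c ^ 4"
    by linarith
  have cardS: "card S' = 3 * ?c * card S" by (simp add: S'_def card_cartesian_product)
  have lay: "\<exists>col pos. layout V E S' (A \<union> A') col pos" if built: "clique_built (Suc k) V E" for V :: "'a set" and E
  proof -
    obtain node top where tp: "tree_partition V E node top" and
      bags: "\<And>x. clique_built k (bag V node x) (E \<inter> bag V node x \<times> bag V node x)"
      using clique_built_tree_partition[OF built] by blast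
    have "\<forall>x. \<exists>col pos. layout (bag V node x) (E \<inter> bag V node x \<times> bag V node x) S F col pos"
      using IH bags by blast
    then obtain col pos where
      lay: "\<And>x. layout (bag V node x) (E \<inter> bag V node x \<times> bag V node x) S F (col x) (pos x)"
      unfolding choice_iff by blast
    obtain f0 where "f0 \<in> F" using F by blast
    then interpret layered_layout V E node top col pos S F f0
      using tp lay by (intro layered_layout.intro layered_layout_axioms.intro)
    show ?thesis
      using layered_layout unfolding tracks_def covers_def S'_def A_def A'_def by blast
  qed
  show ?thesis
    by (intro exI[of _ S'] exI[of _ "A \<union> A'"] conjI allI impI)
      (simp_all only: fin ne card cardS lay not_False_eq_True)
qed

text \<open>The exponents of 6 for \<open>k + 1\<close> and \<open>k\<close> differ by
  \<open>(4 ^ k - 1) / 3\<close>, the exponent in the bound on the number of covers.\<close>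

lemma track_bound_Suc: "track_bound (Suc k) = 3 * 6 ^ ((4 ^ k - 1) div 3) * track_bound k"
proof -
  obtain m where m: "4 ^ k - 3 * k - 1 = 9 * m"
    using track_bound_exponent_exact(2)[of k] by blast
  then have pow: "4 ^ k = 9 * m + 3 * k + 1"
    using track_bound_exponent_exact(1)[of k] by linarith
  then have "(4 ^ Suc k - 3 * Suc k - 1) div 9 = m + (4 ^ k - 1) div 3"
    by simp
  then show ?thesis
    using m by (simp add: track_bound_def power_add)
qed

text \<open>Each step builds tracks of a more complicated type; numbering them by naturals restores
  the type needed for the induction.\<close>

lemma clique_built_layout:
  "\<exists>t F. t \<le> track_bound k \<and> finite F \<and> F \<noteq> {} \<and> card F \<le> 6 ^ ((4 ^ k - 1) div 3) \<and>
    (\<forall>(V :: 'a set) E. clique_built k V E \<longrightarrow>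
      (\<exists>(col :: 'a \<Rightarrow> nat) pos. layout V E {..<t} F col pos))"
proof (induction k)
  case 0
  \<comment> \<open>Without edges one track suffices, and every nonempty clique meets exactly that
    track.\<close>
  have "\<exists>pos. layout V E {..<1} {{0}} (\<lambda>_. 0 :: nat) pos" if built: "clique_built 0 V E" for V :: "'a set" and E
  proof -
    have E: "E = {}" using clique_built_0_no_edges[OF built] .
    obtain pos :: "'a \<Rightarrow> nat" where "inj_on pos V"
      using finite_imp_inj_to_nat_seg[OF clique_built_finite[OF built]] by blast
    then show ?thesis unfolding layout_def E by (intro exI[of _ pos]) auto
  qed
  then have "\<forall>(V :: 'a set) E. clique_built 0 V E \<longrightarrow>
      (\<exists>(col :: 'a \<Rightarrow> nat) pos. layout V E {..<1} {{0}} col pos)"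
    by blast
  then show ?case
    by (intro exI[of _ "1 :: nat"] exI[of _ "{{0 :: nat}}"]) (simp add: track_bound_def)
next
  case (Suc k)
  then obtain t F where t: "t \<le> track_bound k" and F: "finite F" "F \<noteq> {}" "card F \<le> 6 ^ ((4 ^ k - 1) div 3)"
    and IH: "\<forall>(V :: 'a set) E. clique_built k V E \<longrightarrow>
      (\<exists>(col :: 'a \<Rightarrow> nat) pos. layout V E {..<t} F col pos)"
    by blast
  obtain S' :: "(nat \<times> nat set \<times> nat) set" and F' where
    S': "finite S'" "card S' = 3 * card F * t" and
    F': "finite F'" "F' \<noteq> {}" "card F' \<le> 6 * card F ^ 4" and
    lay: "\<And>(V :: 'a set) E. clique_built (Suc k) V E \<Longrightarrow> \<exists>col pos. layout V E S' F' col pos"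
    using clique_built_Suc_layout[OF IH finite_lessThan F(1,2)] unfolding card_lessThan by blast
  obtain h where h: "bij_betw h S' {..<card S'}"
    using ex_bij_betw_finite_nat[OF S'(1)] by (auto simp: atLeast0LessThan)
  then have h: "inj_on h S'" "h ` S' = {..<card S'}" by (auto simp: bij_betw_def)
  have lay': "\<exists>(col :: 'a \<Rightarrow> nat) pos. layout V E {..<card S'} ((`) h ` F') col pos"
    if "clique_built (Suc k) V E" for V :: "'a set" and E
    using lay[OF that] layout_rename[OF _ h(1) clique_built_subset[OF that]] unfolding h(2) by blast
  have "card S' \<le> track_bound (Suc k)"
    unfolding S'(2) track_bound_Suc using t F(3) by (intro mult_mono) auto
  moreover have "card ((`) h ` F') \<le> 6 ^ ((4 ^ Suc k - 1) div 3)"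
  proof -
    have "(4 :: nat) ^ k mod 3 = 1"
      by (simp add: power_mod[symmetric, of 4])
    then have e: "4 ^ k = 3 * (4 ^ k div 3) + (1 :: nat)"
      by (metis mult_div_mod_eq)
    \<comment> \<open>This matches the recursion \<open>6 * c ^ 4\<close>: the exponent is
      multiplied by 4 and increased by 1.\<close>
    have exponent: "(4 ^ Suc k - 1) div 3 = Suc (4 * ((4 ^ k - 1) div 3 :: nat))"
    proof -
      obtain e where "4 ^ k = 3 * e + (1 :: nat)" using e by blast
      then show ?thesis by simp
    qed
    have "card ((`) h ` F') \<le> 6 * card F ^ 4"
      using card_image_le[OF F'(1), of "(`) h"] F'(3) by (rule order_trans)
    also have "\<dots> \<le> 6 * (6 ^ ((4 ^ k - 1) div 3)) ^ 4"
      using F(3) by (intro mult_left_mono power_mono) auto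
    also have "\<dots> = 6 ^ ((4 ^ Suc k - 1) div 3)"
      unfolding exponent by (simp add: power_mult[symmetric] mult.commute)
    finally show ?thesis .
  qed
  ultimately show ?case
    using F' lay' by (intro exI[of _ "card S'"] exI[of _ "(`) h ` F'"]) simp
qed

theorem theorem7p3:
  fixes G :: "'a pair_pre_digraph" and k :: nat
  assumes "pair_graph G"
    and "treewidth G \<le> k"
  shows "has_track_layout (track_bound k) G"
proof -
  interpret pair_graph G by fact
  obtain E where E: "clique_built k (pverts G) E" "parcs G \<subseteq> E"
    using treewidth_clique_built[OF assms] by blast
  obtain t F and col :: "'a \<Rightarrow> nat" and pos where t: "t \<le> track_bound k"
    and L: "layout (pverts G) E {..<t} F col pos"
    using clique_built_layout[where 'a = 'a, of k] E(1) by metis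
  \<comment> \<open>Tracks with index between \<open>t\<close> and \<open>track_bound k\<close> stay
    empty. The layout of the larger graph \<open>E\<close> restricts to its subgraph
    \<open>G\<close>.\<close>
  let ?V = "\<lambda>i. {v \<in> pverts G. col v = i}"
  let ?R = "\<lambda>i. {(u, v) \<in> ?V i \<times> ?V i. pos u < pos v}"
  have "track_assignment G {..<track_bound k} ?V ?R"
  proof -
    have "strict_linear_order_on (?V i) (?R i)" for i
      using layoutD(2)[OF L]
      by (auto simp: strict_linear_order_on_def trans_def irrefl_def total_on_def inj_on_def
          intro: less_trans) (metis linorder_neqE_nat)+
    moreover have "colouring G {..<track_bound k} ?V"
      unfolding colouring_def
    proof (intro conjI)
      show "(\<Union>i\<in>{..<track_bound k}. ?V i) = pverts G"
        using layoutD(1)[OF L] t by fastforce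
      show "disjoint_family_on ?V {..<track_bound k}"
        by (auto simp: disjoint_family_on_def)
      show "\<forall>(v, w)\<in>parcs G. \<forall>i\<in>{..<track_bound k}. \<not> (v \<in> ?V i \<and> w \<in> ?V i)"
        using layoutD(3)[OF L subsetD[OF E(2)]] by fastforce
    qed
    ultimately show ?thesis unfolding track_assignment_def by blast
  qed
  moreover have "\<not> has_X_crossing G {..<track_bound k} ?V ?R"
    unfolding has_X_crossing_def using layoutD(4)[OF L] E(2) by fastforce
  ultimately show ?thesis unfolding has_track_layout_def by blast
qed

end
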